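(* Let $S$ be a semilattice that has infinite breadth. Then there exists a submultiplicative weight $\omega:S\to(0,\infty)$ such that the weighted convolution algebra $\ell^1(S,\omega)$ is not AMNM.
   Context: A semilattice is a commutative semigroup $S$ in which $x^2=x$ for all $x\in S$. Breadth: a finite non-empty subset $E\subseteq S$ is called compressible if there is a proper non-empty subset $E'\subset E$ such that the product of all elements of $E'$ equals the product of all elements of $E$; otherwise $E$ is incompressible. The breadth of $S$ is $\sup\{n\in\mathbb N: S \text{ has an incompressible subset with } n \text{ elements}\}$; so $S$ has infinite breadth if it has incompressible subsets of arbitrarily large finite cardinality. A submultiplicative weight on $S$ is a function $\omega:S\to(0,\infty)$ with $\omega(xy)\le\omega(x)\omega(y)$ for all $x,y\in S$. Then $\ell^1(S,\omega)$ is the set of all $f:S\to\mathbb C$ with $\|f\|=\sum_{s\in S}|f(s)|\omega(s)<\infty$, which is a commutative Banach algebra with the convolution product $(f*g)(x)=\sum_{(s,t)\in S\times S:\, st=x}f(s)g(t)$. For a commutative Banach algebra $A$ with dual space $A^*$, a functional $\psi\in A^*$ is multiplicative if $\psi(ab)=\psi(a)\psi(b)$ for all $a,b\in A$ (the zero functional is included); $\operatorname{Mult}(A)\subseteq A^*$ is the set of multiplicative functionals. For $\delta>0$, $\psi\in A^*$ is $\delta$-multiplicative if the bilinear map $(a,b)\mapsto\psi(a)\psi(b)-\psi(ab)$ has norm at most $\delta$. The algebra $A$ is AMNM if for every $\varepsilon>0$ there is $\delta>0$ such that every $\delta$-multiplicative $\psi\in A^*$ satisfies $\operatorname{dist}(\psi,\operatorname{Mult}(A))<\varepsilon$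 (distance in the norm of $A^*$). *)

theory Defs
  imports "HOL-Analysis.Analysis" "HOL-Library.Extended_Nat"
begin

definition compressible :: "('a \<Rightarrow> 'a \<Rightarrow> 'a) \<Rightarrow> 'a set \<Rightarrow> bool" where
  "compressible mul E \<longleftrightarrow>
     finite E \<and> E \<noteq> {} \<and>
     (\<exists>E'. E' \<noteq> {} \<and> E' \<subset> E \<and> semilattice_set.F mul E' = semilattice_set.F mul E)"

definition incompressible :: "('a \<Rightarrow> 'a \<Rightarrow> 'a) \<Rightarrow> 'a set \<Rightarrow> bool" where
  "incompressible mul E \<longleftrightarrow> finite E \<and> E \<noteq> {} \<and> \<not> compressible mul E"

definition breadth :: "('a \<Rightarrow> 'a \<Rightarrow> 'a) \<Rightarrow> enat" where
  "breadth mul = Sup {enat n | n. \<exists>E. incompressible mul E \<and> card E = n}"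

definition submultiplicative_weight :: "('a \<Rightarrow> 'a \<Rightarrow> 'a) \<Rightarrow> ('a \<Rightarrow> real) \<Rightarrow> bool" where
  "submultiplicative_weight mul \<omega> \<longleftrightarrow>
     (\<forall>x. \<omega> x > 0) \<and> (\<forall>x y. \<omega> (mul x y) \<le> \<omega> x * \<omega> y)"

text \<open>
  The algebra \<open>\<ell>\<^sup>1(S, \<omega>)\<close> depends on the weight, so it cannot be a type; complex normed
  algebras are therefore given by a carrier set together with their operations.
\<close>

record 'b normed_alg =
  alg_carrier :: "'b set"
  alg_add :: "'b \<Rightarrow> 'b \<Rightarrow> 'b"
  alg_scale :: "complex \<Rightarrow> 'b \<Rightarrow> 'b"
  alg_mult :: "'b \<Rightarrow> 'b \<Rightarrow> 'b"
  alg_norm :: "'b \<Rightarrow> real"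

definition weighted_l1 ::
  "('a \<Rightarrow> 'a \<Rightarrow> 'a) \<Rightarrow> ('a \<Rightarrow> real) \<Rightarrow> ('a \<Rightarrow> complex) normed_alg" where
  "weighted_l1 mul \<omega> =
     \<lparr> alg_carrier = {f. (\<lambda>s. cmod (f s) * \<omega> s) summable_on UNIV},
       alg_add = (\<lambda>f g s. f s + g s),
       alg_scale = (\<lambda>c f s. c * f s),
       alg_mult = (\<lambda>f g x. \<Sum>\<^sub>\<infinity>(s, t)\<in>{(s, t). mul s t = x}. f s * g t),
       alg_norm = (\<lambda>f. \<Sum>\<^sub>\<infinity>s. cmod (f s) * \<omega> s) \<rparr>"

text \<open>
  Functionals are functions on the whole underlying type. Their values outside the carrier are
  unconstrained and irrelevant: every notion below only refers to values on the carrier.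
\<close>

definition dual_space :: "'b normed_alg \<Rightarrow> ('b \<Rightarrow> complex) set" where
  "dual_space A =
     {\<psi>. (\<forall>a\<in>alg_carrier A. \<forall>b\<in>alg_carrier A. \<psi> (alg_add A a b) = \<psi> a + \<psi> b) \<and>
          (\<forall>c. \<forall>a\<in>alg_carrier A. \<psi> (alg_scale A c a) = c * \<psi> a) \<and>
          (\<exists>K. \<forall>a\<in>alg_carrier A. cmod (\<psi> a) \<le> K * alg_norm A a)}"

definition unit_ball :: "'b normed_alg \<Rightarrow> 'b set" where
  "unit_ball A = {a \<in> alg_carrier A. alg_norm A a \<le> 1}"

text \<open>
  The suprema below are taken in the reals, so they are meaningful only for bounded maps. This is
  the case wherever they are used, since functionals come from the dual space and the
  multiplication of a Banach algebra is bounded.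
\<close>

definition functional_norm :: "'b normed_alg \<Rightarrow> ('b \<Rightarrow> complex) \<Rightarrow> real" where
  "functional_norm A \<psi> = (SUP a\<in>unit_ball A. cmod (\<psi> a))"

definition bilinear_norm :: "'b normed_alg \<Rightarrow> ('b \<Rightarrow> 'b \<Rightarrow> complex) \<Rightarrow> real" where
  "bilinear_norm A B = (SUP (a, b)\<in>unit_ball A \<times> unit_ball A. cmod (B a b))"

definition Mult :: "'b normed_alg \<Rightarrow> ('b \<Rightarrow> complex) set" where
  "Mult A = {\<psi> \<in> dual_space A.
     \<forall>a\<in>alg_carrier A. \<forall>b\<in>alg_carrier A. \<psi> (alg_mult A a b) = \<psi> a * \<psi> b}"

definition delta_multiplicative :: "'b normed_alg \<Rightarrow> real \<Rightarrow> ('b \<Rightarrow> complex) \<Rightarrow> bool" where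
  "delta_multiplicative A \<delta> \<psi> \<longleftrightarrow>
     \<psi> \<in> dual_space A \<and> bilinear_norm A (\<lambda>a b. \<psi> a * \<psi> b - \<psi> (alg_mult A a b)) \<le> \<delta>"

definition dist_Mult :: "'b normed_alg \<Rightarrow> ('b \<Rightarrow> complex) \<Rightarrow> real" where
  "dist_Mult A \<psi> = (INF \<phi>\<in>Mult A. functional_norm A (\<lambda>a. \<psi> a - \<phi> a))"

definition AMNM :: "'b normed_alg \<Rightarrow> bool" where
  "AMNM A \<longleftrightarrow>
     (\<forall>\<epsilon>>0. \<exists>\<delta>>0. \<forall>\<psi>. delta_multiplicative A \<delta> \<psi> \<longrightarrow> dist_Mult A \<psi> < \<epsilon>)"

end

theory Submission
  imports Defs
begin

text \<open>
  Choose incompressible sets \<open>E n\<close> of growing size and put the point \<open>(n, e)\<close>, for \<open>e \<in> E n\<close>, into the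
  trace of \<open>y\<close> if \<open>y\<close> does not lie above the product of \<open>E n - {e}\<close>. Traces turn products into
  unions, and the trace of \<open>e\<close> meets the \<open>n\<close>-th block of points only in \<open>(n, e)\<close>.

  Let \<open>F\<close> be a finite set of points. The elements whose traces meet \<open>F\<close> in at most half of its points
  behave like a filter as long as only elements of small weight are multiplied, provided the weight
  of such an element is exponential in the size of this intersection. A set of cheap generators
  whose traces meet \<open>F\<close> in single points nevertheless has a cheap product outside of this
  almost-filter, so its indicator function is far from every character. To use one weight for a
  sequence of sets \<open>F k\<close> of growing size, every element has to meet the \<open>F k\<close> in boundedly many
  points, or in more than half of the points.

  Call a set of points large if it has unboundedly many points in a block. If some large set is
  not split by any trace into two large parts, the \<open>F k\<close> can be taken inside it. Otherwise
  the splitting traces yield points \<open>p j\<close> and elements \<open>h k\<close> such that \<open>p j\<close> lies in the trace of \<open>h k\<close>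
  iff \<open>j = k\<close>; then the \<open>F k\<close> are blocks of the \<open>p j\<close>, and the almost-filter of \<open>F k\<close> is
  restricted to the elements whose traces avoid all other blocks.
\<close>

section \<open>Almost multiplicative functionals from almost-filters\<close>

lemma summable_on_nonneg_product:
  fixes u :: "'a \<Rightarrow> real" and v :: "'b \<Rightarrow> real"
  assumes u: "u summable_on UNIV" "\<And>s. u s \<ge> 0" and v: "v summable_on UNIV" "\<And>t. v t \<ge> 0"
  shows "(\<lambda>(s, t). u s * v t) summable_on UNIV"
    and "(\<Sum>\<^sub>\<infinity>(s, t). u s * v t) = (\<Sum>\<^sub>\<infinity>s. u s) * (\<Sum>\<^sub>\<infinity>t. v t)"
proof -
  have "(\<lambda>p. norm (case p of (s, t) \<Rightarrow> u s * v t)) summable_on (UNIV \<times> UNIV)"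
    by (subst Infinite_Sum.abs_summable_on_Sigma_iff)
      (auto simp: u v abs_mult infsum_cmult_right' infsum_nonneg
            intro!: summable_on_cmult_right summable_on_cmult_left)
  then show *: "(\<lambda>(s, t). u s * v t) summable_on UNIV"
    by (simp add: case_prod_unfold u v abs_mult)
  show "(\<Sum>\<^sub>\<infinity>(s, t). u s * v t) = (\<Sum>\<^sub>\<infinity>s. u s) * (\<Sum>\<^sub>\<infinity>t. v t)"
    using infsum_Sigma_banach[of "\<lambda>(s, t). u s * v t" UNIV "\<lambda>_. UNIV"] *
    by (simp add: infsum_cmult_right' infsum_cmult_left')
qed

text \<open>Idempotence gives \<open>\<omega> x \<le> \<omega> x * \<omega> x\<close>. Hence the
  weighted norm dominates the unweighted one.\<close>

lemma submultiplicative_weight_ge_1: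
  assumes "semilattice mul" "submultiplicative_weight mul \<omega>"
  shows "\<omega> x \<ge> 1"
proof -
  have "\<omega> x \<le> \<omega> x * \<omega> x" "\<omega> x > 0"
    using assms semilattice.idem[of mul x] unfolding submultiplicative_weight_def by metis+
  then show ?thesis by simp
qed

text \<open>A real supremum bounds its members only if the set is bounded above; continuity of both
  functionals provides this bound.\<close>

lemma functional_norm_diff_ge:
  assumes "\<psi> \<in> dual_space A" "\<phi> \<in> dual_space A" "a \<in> unit_ball A"
    and norm_nonneg: "\<And>a. a \<in> alg_carrier A \<Longrightarrow> alg_norm A a \<ge> 0"
  shows "cmod (\<psi> a - \<phi> a) \<le> functional_norm A (\<lambda>a. \<psi> a - \<phi> a)"
proof -
  obtain K1 K2 where K: "\<And>a. a \<in> alg_carrier A \<Longrightarrow> cmod (\<psi> a) \<le> K1 * alg_norm A a"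
    "\<And>a. a \<in> alg_carrier A \<Longrightarrow> cmod (\<phi> a) \<le> K2 * alg_norm A a"
    using assms(1,2) unfolding dual_space_def by blast
  have bound: "cmod (\<psi> a - \<phi> a) \<le> \<bar>K1\<bar> + \<bar>K2\<bar>" if "a \<in> unit_ball A" for a
  proof -
    have a: "a \<in> alg_carrier A" "0 \<le> alg_norm A a" "alg_norm A a \<le> 1"
      using that norm_nonneg by (auto simp: unit_ball_def)
    have "K * alg_norm A a \<le> \<bar>K\<bar>" for K
      using a(2,3) by (metis abs_ge_self abs_ge_zero mult.right_neutral mult_mono)
    then have "cmod (\<psi> a) \<le> \<bar>K1\<bar>" "cmod (\<phi> a) \<le> \<bar>K2\<bar>"
      using K a(1) order_trans by blast+
    then show ?thesis
      using norm_triangle_ineq4[of "\<psi> a" "\<phi> a"] by linarith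
  qed
  show ?thesis
    unfolding functional_norm_def
    by (rule cSUP_upper[OF assms(3)]) (use bound in \<open>auto intro!: bdd_aboveI2\<close>)
qed

section \<open>Point masses and indicator functionals on the weighted algebra\<close>

definition point_mass :: "'a \<Rightarrow> 'a \<Rightarrow> complex" where
  "point_mass s = (\<lambda>t. if t = s then 1 else 0)"

lemma infsum_eq_single:
  assumes "a \<in> A" "\<And>x. x \<in> A \<Longrightarrow> x \<noteq> a \<Longrightarrow> f x = 0"
  shows "infsum f A = f a"
proof -
  have "infsum f A = infsum f {a}"
    by (rule infsum_cong_neutral) (use assms in auto)
  then show ?thesis by simp
qed

lemma infsum_point_mass: "(\<Sum>\<^sub>\<infinity>t\<in>X. point_mass s t) = (if s \<in> X then 1 else 0)"
proof (cases "s \<in> X")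
  case True
  then show ?thesis
    by (subst infsum_eq_single[of s]) (auto simp: point_mass_def)
next
  case False
  then show ?thesis
    by (auto simp: point_mass_def intro!: infsum_0)
qed

lemma point_mass_in_weighted_l1: "point_mass s \<in> alg_carrier (weighted_l1 mul \<omega>)"
  by (auto simp: weighted_l1_def point_mass_def
      intro!: finite_nonzero_values_imp_summable_on finite_subset[of _ "{s}"] split: if_splits)

lemma weighted_l1_norm_scale_point_mass:
  "alg_norm (weighted_l1 mul \<omega>) (alg_scale (weighted_l1 mul \<omega>) c (point_mass s)) = cmod c * \<omega> s"
  unfolding weighted_l1_def by (simp, subst infsum_eq_single[of s]) (auto simp: point_mass_def)

lemma weighted_l1_scale_closed:
  "f \<in> alg_carrier (weighted_l1 mul \<omega>) \<Longrightarrow>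
    alg_scale (weighted_l1 mul \<omega>) c f \<in> alg_carrier (weighted_l1 mul \<omega>)"
  by (auto simp: weighted_l1_def norm_mult mult.assoc intro!: summable_on_cmult_right)

text \<open>Through point masses, a multiplicative functional restricts to a multiplicative function
  on the semilattice.\<close>

lemma weighted_l1_mult_point_mass:
  "alg_mult (weighted_l1 mul \<omega>) (point_mass s) (point_mass t) = point_mass (mul s t)"
proof
  fix x
  show "alg_mult (weighted_l1 mul \<omega>) (point_mass s) (point_mass t) x = point_mass (mul s t) x"
  proof (cases "x = mul s t")
    case True
    then show ?thesis
      unfolding weighted_l1_def
      by (simp, subst infsum_eq_single[of "(s, t)"]) (auto simp: point_mass_def split: if_splits)
  next
    case False
    then show ?thesis
      by (auto simp: weighted_l1_def point_mass_def intro!: infsum_0)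
  qed
qed

text \<open>The functional induced by the indicator function of \<open>X\<close>.\<close>

definition sum_on :: "'a set \<Rightarrow> ('a \<Rightarrow> complex) \<Rightarrow> complex" where
  "sum_on X f = (\<Sum>\<^sub>\<infinity>s\<in>X. f s)"

lemma weighted_l1_norm_nonneg:
  assumes "\<And>x. \<omega> x \<ge> 1"
  shows "alg_norm (weighted_l1 mul \<omega>) f \<ge> 0"
proof -
  have "\<omega> x \<ge> 0" for x using assms[of x] by linarith
  then show ?thesis by (auto simp: weighted_l1_def intro!: infsum_nonneg)
qed

lemma weighted_l1_abs_summable:
  assumes "\<And>x. \<omega> x \<ge> 1" "f \<in> alg_carrier (weighted_l1 mul \<omega>)"
  shows "(\<lambda>s. cmod (f s)) summable_on UNIV" "f summable_on X"
    "(\<Sum>\<^sub>\<infinity>s\<in>X. cmod (f s)) \<le> alg_norm (weighted_l1 mul \<omega>) f"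
proof -
  have le: "cmod (f s) \<le> cmod (f s) * \<omega> s" for s
    using assms(1)[of s] mult_left_mono[of 1 "\<omega> s" "cmod (f s)"] by simp
  have summable: "(\<lambda>s. cmod (f s) * \<omega> s) summable_on UNIV"
    using assms(2) by (simp add: weighted_l1_def)
  then show *: "(\<lambda>s. cmod (f s)) summable_on UNIV"
    by (rule summable_on_comparison_test) (use le in auto)
  then show "f summable_on X"
    using abs_summable_summable summable_on_subset_banach by blast
  have "(\<lambda>s. cmod (f s)) summable_on X"
    using * summable_on_subset_banach by blast
  then show "(\<Sum>\<^sub>\<infinity>s\<in>X. cmod (f s)) \<le> alg_norm (weighted_l1 mul \<omega>) f"
    unfolding weighted_l1_def using summable
    by simp (rule infsum_mono_neutral, use le in \<open>auto intro: order_trans[OF norm_ge_zero le]\<close>)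
qed

lemma sum_on_dual:
  assumes "\<And>x. \<omega> x \<ge> 1"
  shows "sum_on X \<in> dual_space (weighted_l1 mul \<omega>)"
proof -
  let ?A = "weighted_l1 mul \<omega>"
  have 1: "sum_on X (alg_add ?A f g) = sum_on X f + sum_on X g"
    if "f \<in> alg_carrier ?A" "g \<in> alg_carrier ?A" for f g
    using weighted_l1_abs_summable(2)[where X=X, OF assms] that
    by (simp add: sum_on_def weighted_l1_def infsum_add)
  have 2: "sum_on X (alg_scale ?A c f) = c * sum_on X f" for c f
    by (simp add: sum_on_def weighted_l1_def infsum_cmult_right')
  have 3: "cmod (sum_on X f) \<le> 1 * alg_norm ?A f" if "f \<in> alg_carrier ?A" for f
  proof -
    have "(\<lambda>s. cmod (f s)) summable_on X"
      using weighted_l1_abs_summable(1)[OF assms that] summable_on_subset_banach by blast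
    then show ?thesis
      unfolding sum_on_def
      using norm_infsum_bound weighted_l1_abs_summable(3)[where X=X, OF assms that] by fastforce
  qed
  show ?thesis
    unfolding dual_space_def using 1 2 3 by blast
qed

text \<open>The defect is the sum over pairs \<open>(s, t)\<close> of \<open>f s * g t\<close> times
  the defect of the indicator function, which is at most 1 in modulus. It vanishes if
  \<open>\<omega> s * \<omega> t \<le> 1 / \<delta>\<close>; otherwise
  \<open>1 \<le> \<delta> * (\<omega> s * \<omega> t)\<close>, so the weights pay for it.\<close>

lemma sum_on_delta_multiplicative:
  fixes mul :: "'a \<Rightarrow> 'a \<Rightarrow> 'a"
  assumes ge1: "\<And>x. \<omega> x \<ge> 1" and "\<delta> > 0"
    and closed: "\<And>x y. \<omega> x * \<omega> y \<le> 1 / \<delta> \<Longrightarrow> mul x y \<in> X \<longleftrightarrow> x \<in> X \<and> y \<in> X"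
  shows "delta_multiplicative (weighted_l1 mul \<omega>) \<delta> (sum_on X)"
proof -
  let ?A = "weighted_l1 mul \<omega>"
  have bound: "cmod (sum_on X f * sum_on X g - sum_on X (alg_mult ?A f g)) \<le> \<delta>"
    if "f \<in> unit_ball ?A" "g \<in> unit_ball ?A" for f g
  proof -
    have fg: "f \<in> alg_carrier ?A" "g \<in> alg_carrier ?A" "alg_norm ?A f \<le> 1" "alg_norm ?A g \<le> 1"
      using that by (auto simp: unit_ball_def)
    define h where "h = (\<lambda>(s, t). f s * g t)"
    define k where "k = (\<lambda>(s, t). (cmod (f s) * \<omega> s) * (cmod (g t) * \<omega> t))"
    have \<omega>0: "\<omega> x \<ge> 0" for x using ge1[of x] by linarith
    have k: "k summable_on UNIV" "infsum k UNIV = alg_norm ?A f * alg_norm ?A g"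
      unfolding k_def
      using summable_on_nonneg_product[of "\<lambda>s. cmod (f s) * \<omega> s" "\<lambda>s. cmod (g s) * \<omega> s"] fg(1,2) \<omega>0
      by (auto simp: weighted_l1_def)
    have "(\<lambda>(s, t). cmod (f s) * cmod (g t)) summable_on UNIV"
      using summable_on_nonneg_product(1)[of "\<lambda>s. cmod (f s)" "\<lambda>s. cmod (g s)"]
        weighted_l1_abs_summable(1)[OF ge1 fg(1)] weighted_l1_abs_summable(1)[OF ge1 fg(2)] by auto
    then have h_abs: "(\<lambda>p. cmod (h p)) summable_on UNIV"
      by (simp add: h_def case_prod_unfold norm_mult)
    then have h: "h summable_on Y" for Y
      using abs_summable_summable summable_on_subset_banach by blast
    define T where "T = {(s, t). mul s t \<in> X}"
    have prod: "sum_on X f * sum_on X g = infsum h (X \<times> X)"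
      using infsum_Sigma_banach[of h X "\<lambda>_. X"] h
      by (simp add: h_def sum_on_def infsum_cmult_right' infsum_cmult_left')
    \<comment> \<open>Summing a convolution over \<open>X\<close> collects the fibres of
      \<open>mul\<close> over \<open>X\<close>; \<open>snd\<close> identifies their disjoint union
      with \<open>T\<close>.\<close>
    have "sum_on X (alg_mult ?A f g) = infsum h T"
    proof -
      let ?D = "Sigma X (\<lambda>x. {(s, t). mul s t = x})"
      have bij: "bij_betw snd ?D T"
        by (rule bij_betwI[where g = "\<lambda>(s, t). (mul s t, (s, t))"]) (auto simp: T_def)
      then have "(\<lambda>q. h (snd q)) summable_on ?D"
        using h summable_on_reindex_bij_betw[OF bij] by blast
      from infsum_Sigma_banach[OF this] show ?thesis
        using infsum_reindex_bij_betw[OF bij, of h]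
        by (simp add: sum_on_def weighted_l1_def h_def)
    qed
    \<comment> \<open>Both sums are extended by zero to all pairs, so that they can be compared
      termwise.\<close>
    moreover have "infsum h Y = (\<Sum>\<^sub>\<infinity>p. of_bool (p \<in> Y) * h p)" for Y
      by (rule infsum_cong_neutral) auto
    moreover have "(\<lambda>p. of_bool (p \<in> Y) * h p) summable_on UNIV" for Y
      using h[of Y] by (subst summable_on_cong_neutral[of Y _ h]) auto
    ultimately have sums: "((\<lambda>p. of_bool (p \<in> X \<times> X) * h p - of_bool (p \<in> T) * h p) has_sum
      (sum_on X f * sum_on X g - sum_on X (alg_mult ?A f g))) UNIV"
      using prod has_sum_add[OF has_sum_infsum has_sum_uminusI[OF has_sum_infsum],
          of "\<lambda>p. of_bool (p \<in> X \<times> X) * h p" UNIV "\<lambda>p. of_bool (p \<in> T) * h p"] by simp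
    have le: "cmod (of_bool (p \<in> X \<times> X) * h p - of_bool (p \<in> T) * h p) \<le> \<delta> * k p" for p
    proof (cases p)
      case (Pair s t)
      have "cmod (f s) * cmod (g t) \<le> \<delta> * ((cmod (f s) * \<omega> s) * (cmod (g t) * \<omega> t))"
        if "\<not> \<omega> s * \<omega> t \<le> 1 / \<delta>"
      proof -
        have "1 \<le> \<delta> * (\<omega> s * \<omega> t)" using that \<open>\<delta> > 0\<close> by (simp add: field_simps)
        then have "cmod (f s) * cmod (g t) * 1 \<le> cmod (f s) * cmod (g t) * (\<delta> * (\<omega> s * \<omega> t))"
          by (intro mult_left_mono) auto
        then show ?thesis by (simp add: mult_ac)
      qed
      moreover have "0 \<le> \<delta> * ((cmod (f s) * \<omega> s) * (cmod (g t) * \<omega> t))"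
        using \<omega>0 \<open>\<delta> > 0\<close> by simp
      ultimately show ?thesis
        using closed[of s t] Pair by (auto simp: T_def h_def k_def norm_mult)
    qed
    have dk: "(\<lambda>p. \<delta> * k p) summable_on UNIV"
      using k(1) by (rule summable_on_cmult_right)
    have "cmod (sum_on X f * sum_on X g - sum_on X (alg_mult ?A f g)) \<le> (\<Sum>\<^sub>\<infinity>p. \<delta> * k p)"
      by (rule norm_infsum_le[OF sums has_sum_infsum[OF dk] le])
    also have "\<dots> = \<delta> * (alg_norm ?A f * alg_norm ?A g)"
      using k by (simp add: infsum_cmult_right')
    also have "\<dots> \<le> \<delta>"
      using fg(3,4) weighted_l1_norm_nonneg[where \<omega>=\<omega>, OF ge1] \<open>\<delta> > 0\<close>
      by (simp add: mult_le_one)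
    finally show ?thesis .
  qed
  have "(\<lambda>_. 0) \<in> unit_ball ?A"
    by (simp add: unit_ball_def weighted_l1_def)
  then have "unit_ball ?A \<times> unit_ball ?A \<noteq> {}" by blast
  then have "bilinear_norm ?A (\<lambda>a b. sum_on X a * sum_on X b - sum_on X (alg_mult ?A a b)) \<le> \<delta>"
    unfolding bilinear_norm_def by (rule cSUP_least) (use bound in auto)
  then show ?thesis
    using sum_on_dual[OF ge1] by (simp add: delta_multiplicative_def)
qed

text \<open>On point masses a multiplicative functional takes only the values 0 and 1. If it is 1 on
  all of \<open>G\<close>, it is 1 at the product, which lies outside \<open>X\<close>; otherwise it
  is 0 at some member of \<open>G\<close>, which lies in \<open>X\<close>. Either way it differs by
  1 from the indicator of \<open>X\<close> at an element of weight at most \<open>C\<close>, so the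
  distance is at least \<open>1 / C\<close> for every \<open>\<delta>\<close>.\<close>

lemma not_AMNM_if_almost_filters:
  fixes mul :: "'a \<Rightarrow> 'a \<Rightarrow> 'a"
  assumes "semilattice mul" and \<omega>: "submultiplicative_weight mul \<omega>" and "C > 0"
    and ex: "\<And>\<delta>. \<delta> > 0 \<Longrightarrow> \<exists>X G.
        (\<forall>x y. \<omega> x * \<omega> y \<le> 1 / \<delta> \<longrightarrow> (mul x y \<in> X \<longleftrightarrow> x \<in> X \<and> y \<in> X)) \<and>
        finite G \<and> G \<noteq> {} \<and> G \<subseteq> X \<and> (\<forall>g\<in>G. \<omega> g \<le> C) \<and>
        semilattice_set.F mul G \<notin> X \<and> \<omega> (semilattice_set.F mul G) \<le> C"
  shows "\<not> AMNM (weighted_l1 mul \<omega>)"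
proof
  let ?A = "weighted_l1 mul \<omega>"
  assume "AMNM ?A"
  then obtain \<delta> where \<delta>: "\<delta> > 0" "\<And>\<psi>. delta_multiplicative ?A \<delta> \<psi> \<Longrightarrow> dist_Mult ?A \<psi> < 1 / C"
    using \<open>C > 0\<close> unfolding AMNM_def by (metis divide_pos_pos zero_less_one)
  interpret semilattice mul by fact
  interpret semilattice_set mul ..
  have ge1: "\<omega> x \<ge> 1" for x using submultiplicative_weight_ge_1 assms(1) \<omega> .
  obtain X G where closed: "\<And>x y. \<omega> x * \<omega> y \<le> 1 / \<delta> \<Longrightarrow> mul x y \<in> X \<longleftrightarrow> x \<in> X \<and> y \<in> X"
    and G: "finite G" "G \<noteq> {}" "G \<subseteq> X" "\<And>g. g \<in> G \<Longrightarrow> \<omega> g \<le> C" "F G \<notin> X" "\<omega> (F G) \<le> C"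
    using ex[OF \<delta>(1)] by blast
  have far: "1 / C \<le> functional_norm ?A (\<lambda>a. sum_on X a - \<phi> a)" if \<phi>: "\<phi> \<in> Mult ?A" for \<phi>
  proof -
    define \<theta> where "\<theta> s = \<phi> (point_mass s)" for s
    have dual: "\<phi> \<in> dual_space ?A" using \<phi> by (simp add: Mult_def)
    have \<theta>: "\<theta> (mul s t) = \<theta> s * \<theta> t" for s t
    proof -
      have "\<phi> (alg_mult ?A (point_mass s) (point_mass t)) = \<theta> s * \<theta> t"
        using \<phi> by (simp add: \<theta>_def Mult_def point_mass_in_weighted_l1)
      then show ?thesis by (simp add: \<theta>_def weighted_l1_mult_point_mass)
    qed
    have \<theta>01: "\<theta> s = 0 \<or> \<theta> s = 1" for s
      using \<theta>[of s s] by simp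
    have \<theta>G: "\<theta> (F H) = 1" if "finite H" "H \<noteq> {}" "\<forall>g\<in>H. \<theta> g = 1" for H
      using that by (induction H rule: finite_ne_induct) (auto simp: \<theta>)
    obtain s where s: "\<omega> s \<le> C" "cmod ((if s \<in> X then 1 else 0) - \<theta> s) = 1"
    proof (cases "\<forall>g\<in>G. \<theta> g = 1")
      case True
      then show thesis using that[of "F G"] \<theta>G G by simp
    next
      case False
      then obtain g where "g \<in> G" "\<theta> g = 0" using \<theta>01 by blast
      then show thesis using that[of g] G(3,4) by auto
    qed
    have "\<omega> s > 0" using ge1[of s] by linarith
    define a where "a = alg_scale ?A (1 / complex_of_real (\<omega> s)) (point_mass s)"
    have a: "a \<in> unit_ball ?A"
      unfolding unit_ball_def a_def using \<open>\<omega> s > 0\<close>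
      by (auto simp: weighted_l1_norm_scale_point_mass norm_divide
               intro!: weighted_l1_scale_closed point_mass_in_weighted_l1)
    have scale: "\<rho> a = (1 / complex_of_real (\<omega> s)) * \<rho> (point_mass s)" if "\<rho> \<in> dual_space ?A" for \<rho>
      using that by (simp add: dual_space_def a_def point_mass_in_weighted_l1)
    have "sum_on X a - \<phi> a = ((if s \<in> X then 1 else 0) - \<theta> s) / complex_of_real (\<omega> s)"
      using scale[OF dual] scale[OF sum_on_dual[OF ge1], of X]
      by (simp add: sum_on_def infsum_point_mass \<theta>_def diff_divide_distrib)
    then have "cmod (sum_on X a - \<phi> a) = 1 / \<omega> s"
      using s(2) \<open>\<omega> s > 0\<close> by (simp add: norm_divide)
    moreover have "1 / C \<le> 1 / \<omega> s"
      using s(1) \<open>\<omega> s > 0\<close> by (simp add: frac_le)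
    moreover have "cmod (sum_on X a - \<phi> a) \<le> functional_norm ?A (\<lambda>a. sum_on X a - \<phi> a)"
      by (rule functional_norm_diff_ge[OF sum_on_dual[OF ge1] dual a weighted_l1_norm_nonneg[OF ge1]])
    ultimately show ?thesis by linarith
  qed
  \<comment> \<open>The zero functional shows that the infimum defining \<open>dist_Mult\<close>
    ranges over a nonempty set.\<close>
  have "(\<lambda>_. 0) \<in> Mult ?A"
    by (auto simp: Mult_def dual_space_def intro!: exI[of _ 0])
  then have "1 / C \<le> dist_Mult ?A (sum_on X)"
    unfolding dist_Mult_def by (intro cINF_greatest[OF _ far]) auto
  then show False
    using \<delta>(2)[OF sum_on_delta_multiplicative[where \<omega>=\<omega>, OF ge1 \<delta>(1) closed]] by simp
qed

section \<open>Splitting large sets of points\<close>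

text \<open>Finite subsets \<open>G\<close> are used because \<open>card\<close> of an infinite set
  is 0; a single infinite block thus makes a set large.\<close>

definition large :: "(nat \<times> 'b) set \<Rightarrow> bool" where
  "large A \<longleftrightarrow> (\<forall>K. \<exists>n G. G \<subseteq> A \<inter> fst -` {n} \<and> finite G \<and> K \<le> card G)"

definition splits :: "(nat \<times> 'b) set \<Rightarrow> (nat \<times> 'b) set \<Rightarrow> bool" where
  "splits y A \<longleftrightarrow> large (A \<inter> y) \<and> large (A - y)"

text \<open>The family \<open>\<Y>\<close> is a parameter because the recursion shrinks it together
  with \<open>A\<close>.\<close>

definition hereditarily_split :: "(nat \<times> 'b) set set \<Rightarrow> (nat \<times> 'b) set \<Rightarrow> bool" where
  "hereditarily_split \<Y> A \<longleftrightarrow> large A \<and> (\<forall>B\<subseteq>A. large B \<longrightarrow> (\<exists>y\<in>\<Y>. splits y B))"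

section \<open>Partition properties of large sets\<close>

lemma largeE:
  assumes "large A"
  obtains n G where "G \<subseteq> A" "G \<subseteq> fst -` {n}" "finite G" "K \<le> card G"
  using assms[unfolded large_def, rule_format, of K] by auto

lemma not_largeE:
  assumes "\<not> large A"
  obtains K where "\<And>n G. G \<subseteq> A \<Longrightarrow> G \<subseteq> fst -` {n} \<Longrightarrow> finite G \<Longrightarrow> card G < K"
proof -
  obtain K where "\<not> (\<exists>n G. G \<subseteq> A \<inter> fst -` {n} \<and> finite G \<and> K \<le> card G)"
    using assms unfolding large_def not_all by (rule exE)
  then have "card G < K" if "G \<subseteq> A" "G \<subseteq> fst -` {n}" "finite G" for n G
    using that by (metis Int_subset_iff not_le)
  then show thesis by (rule that)
qed

lemma large_mono:
  assumes "large A" "A \<subseteq> B"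
  shows "large B"
proof (rule ccontr)
  assume "\<not> large B"
  then obtain K where K: "\<And>n G. G \<subseteq> B \<Longrightarrow> G \<subseteq> fst -` {n} \<Longrightarrow> finite G \<Longrightarrow> card G < K"
    by (rule not_largeE) blast
  obtain n G where "G \<subseteq> A" "G \<subseteq> fst -` {n}" "finite G" "K \<le> card G"
    using assms(1) by (rule largeE)
  then show False using K[of G n] assms(2) by auto
qed

lemma finite_not_large: "finite A \<Longrightarrow> \<not> large A"
proof
  assume "finite A" "large A"
  from \<open>large A\<close> obtain n G where "G \<subseteq> A" "Suc (card A) \<le> card G"
    by (rule largeE[of A "Suc (card A)"])
  then show False
    using card_mono[of A G] \<open>finite A\<close> by auto
qed

text \<open>Bounds on the blocks of two sets add up, so the sets that are not large form an
  ideal.\<close>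

lemma large_Un:
  assumes "large (A \<union> B)"
  shows "large A \<or> large B"
proof (rule ccontr)
  assume "\<not> ?thesis"
  then have "\<not> large A" "\<not> large B" by simp_all
  obtain K where K: "\<And>n G. G \<subseteq> A \<Longrightarrow> G \<subseteq> fst -` {n} \<Longrightarrow> finite G \<Longrightarrow> card G < K"
    using \<open>\<not> large A\<close> by (rule not_largeE) blast
  obtain L where L: "\<And>n G. G \<subseteq> B \<Longrightarrow> G \<subseteq> fst -` {n} \<Longrightarrow> finite G \<Longrightarrow> card G < L"
    using \<open>\<not> large B\<close> by (rule not_largeE) blast
  obtain n G where G: "G \<subseteq> A \<union> B" "G \<subseteq> fst -` {n}" "finite G" "K + L \<le> card G"
    using assms by (rule largeE)
  have "card (G \<inter> A) < K" "card (G \<inter> B) < L"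
    using G by (auto intro!: K[of _ n] L[of _ n])
  moreover have "card G \<le> card (G \<inter> A) + card (G \<inter> B)"
    by (rule order_trans[OF card_mono card_Un_le]) (use G in auto)
  ultimately show False using G(4) by linarith
qed

lemma large_pigeonhole:
  assumes "finite C" "large A" "f ` A \<subseteq> C"
  shows "\<exists>c. large {a \<in> A. f a = c}"
  using assms
proof (induction C arbitrary: A rule: finite_induct)
  case empty
  then show ?case using finite_not_large[of A] by auto
next
  case (insert c C)
  have "large ({a \<in> A. f a = c} \<union> {a \<in> A. f a \<noteq> c})"
    by (rule large_mono[OF insert.prems(1)]) auto
  then consider "large {a \<in> A. f a = c}" | "large {a \<in> A. f a \<noteq> c}"
    using large_Un by blast
  then show ?case
  proof cases
    case 2
    then obtain d where "large {a \<in> {a \<in> A. f a \<noteq> c}. f a = d}"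
      using insert.IH[of "{a \<in> A. f a \<noteq> c}"] insert.prems by auto
    then have "large {a \<in> A. f a = d}" by (rule large_mono) auto
    then show ?thesis ..
  qed blast
qed

lemma splits_mono: "splits y B \<Longrightarrow> B \<subseteq> A \<Longrightarrow> splits y A"
  unfolding splits_def
  by (elim conjE, intro conjI; erule large_mono) auto

lemma large_almost_subset:
  assumes "large A" "finite H" "A \<subseteq> H \<union> D"
  shows "large (A \<inter> D)"
proof -
  have "large ((A \<inter> H) \<union> (A \<inter> D))"
    by (rule large_mono[OF assms(1)]) (use assms(3) in auto)
  then show ?thesis using large_Un finite_not_large[of "A \<inter> H"] assms(2) by blast
qed

lemma large_UN:
  assumes "\<And>k. F k \<subseteq> fst -` {n k}" "\<And>k. finite (F k)" "\<And>k::nat. k \<le> card (F k)"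
  shows "large (\<Union>k. F k)"
  unfolding large_def
proof
  fix K
  show "\<exists>m G. G \<subseteq> (\<Union>k. F k) \<inter> fst -` {m} \<and> finite G \<and> K \<le> card G"
    using assms by (intro exI[of _ "n K"] exI[of _ "F K"]) auto
qed

section \<open>Orthogonal points and traces from hereditary splitting\<close>

text \<open>The points of \<open>H\<close> are treated one by one. As the current set is large,
  failure of hereditary splitting gives a large subset that no member missing the new point splits;
  by \<open>splits_mono\<close>, shrinking preserves what was achieved for earlier points.\<close>

lemma unsplit_refinement:
  assumes "finite H" "large D"
    and "\<And>p E. p \<in> H \<Longrightarrow> E \<subseteq> D \<Longrightarrow> \<not> hereditarily_split {z \<in> \<Y>. p \<notin> z} E"
  shows "\<exists>E\<subseteq>D. large E \<and> (\<forall>z\<in>\<Y>. \<not> H \<subseteq> z \<longrightarrow> \<not> splits z E)"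
  using assms
proof (induction H rule: finite_induct)
  case empty
  then show ?case by auto
next
  case (insert p H)
  then obtain E where E: "E \<subseteq> D" "large E" "\<forall>z\<in>\<Y>. \<not> H \<subseteq> z \<longrightarrow> \<not> splits z E"
    by auto
  then have "\<not> hereditarily_split {z \<in> \<Y>. p \<notin> z} E"
    using insert.prems by blast
  then obtain E' where "E' \<subseteq> E" "large E'" "\<forall>z\<in>\<Y>. p \<notin> z \<longrightarrow> \<not> splits z E'"
    using E(2) unfolding hereditarily_split_def by blast
  then show ?case
    using E splits_mono[of _ E' E] by (intro exI[of _ E']) blast
qed

text \<open>
  If the conclusion failed, one could choose finite sets \<open>F k\<close> one after the other so that every
  member of \<open>\<Y>\<close> missing a point of \<open>F k\<close> does not split the reservoir from which all later \<open>F j\<close>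
  are taken. A member that splits the union of the \<open>F k\<close> would then contain all of them.
\<close>
lemma hereditarily_split_step:
  assumes hs: "hereditarily_split \<Y> A"
  shows "\<exists>y\<in>\<Y>. \<exists>p\<in>A \<inter> y. \<exists>D\<subseteq>A - y. hereditarily_split {z \<in> \<Y>. p \<notin> z} D"
proof (rule ccontr)
  assume contra: "\<not> ?thesis"
  have neg: "\<not> hereditarily_split {z \<in> \<Y>. p \<notin> z} D"
    if "y \<in> \<Y>" "p \<in> A \<inter> y" "D \<subseteq> A - y" for y p D
  proof
    assume "hereditarily_split {z \<in> \<Y>. p \<notin> z} D"
    with that have "\<exists>y\<in>\<Y>. \<exists>p\<in>A \<inter> y. \<exists>D\<subseteq>A - y. hereditarily_split {z \<in> \<Y>. p \<notin> z} D"
      by (intro bexI[of _ y] bexI[of _ p] exI[of _ D] conjI)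
    with contra show False by (rule notE)
  qed
  \<comment> \<open>At stage \<open>k\<close>, \<open>F\<close> is taken from the reservoir
    \<open>D\<close>, and \<open>E\<close> is the next reservoir.\<close>
  define Q where "Q k D F n E \<longleftrightarrow> F \<subseteq> D \<inter> fst -` {n} \<and> finite F \<and> k \<le> card F \<and> E \<subseteq> D \<and>
      (\<forall>z\<in>\<Y>. \<not> F \<subseteq> z \<longrightarrow> \<not> splits z E)" for k :: nat and D F n E
  have step: "\<exists>E. (E \<subseteq> A \<and> large E) \<and> (\<exists>F n. Q k D F n E)" if D: "D \<subseteq> A \<and> large D" for D k
  proof -
    have "\<exists>y\<in>\<Y>. splits y D"
      using hs D by (simp add: hereditarily_split_def)
    then obtain y where y: "y \<in> \<Y>" "splits y D" by (rule bexE)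
    then have "large (D \<inter> y)" "large (D - y)" by (simp_all add: splits_def)
    \<comment> \<open>\<open>F\<close> is placed inside \<open>y\<close> and the next reservoir
      outside, so that \<open>neg\<close> applies to every point of \<open>F\<close>.\<close>
    obtain n F where F: "F \<subseteq> D \<inter> y" "F \<subseteq> fst -` {n}" "finite F" "k \<le> card F"
      using \<open>large (D \<inter> y)\<close> by (rule largeE)
    have "\<exists>E\<subseteq>D - y. large E \<and> (\<forall>z\<in>\<Y>. \<not> F \<subseteq> z \<longrightarrow> \<not> splits z E)"
      by (rule unsplit_refinement[OF F(3) \<open>large (D - y)\<close>], rule neg[OF y(1)]) (use F(1) D in auto)
    then obtain E where E: "E \<subseteq> D - y" "large E" "\<forall>z\<in>\<Y>. \<not> F \<subseteq> z \<longrightarrow> \<not> splits z E"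
      by (elim exE conjE)
    then have "E \<subseteq> A" "E \<subseteq> D" using D by auto
    then have "Q k D F n E"
      unfolding Q_def using F E(3) by (intro conjI) auto
    then show ?thesis using \<open>E \<subseteq> A\<close> \<open>large E\<close> by blast
  qed
  have "\<exists>D. \<forall>k. (D k \<subseteq> A \<and> large (D k)) \<and> (\<exists>F n. Q k (D k) F n (D (Suc k)))"
  proof (rule dependent_nat_choice)
    show "\<exists>D. D \<subseteq> A \<and> large D" using hs unfolding hereditarily_split_def by blast
  qed (fact step)
  then obtain D where D: "\<And>k. D k \<subseteq> A" and "\<And>k. \<exists>F n. Q k (D k) F n (D (Suc k))"
    by auto
  then obtain F n where Q: "\<And>k. Q k (D k) (F k) (n k) (D (Suc k))"
    by metis
  have anti: "antimono D"
    using Q by (auto simp: Q_def decseq_Suc_iff)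
  have F: "F k \<subseteq> D k" "F k \<subseteq> fst -` {n k}" "finite (F k)" "k \<le> card (F k)" for k
    using Q[of k] by (auto simp: Q_def)
  have "(\<Union>k. F k) \<subseteq> A" using F(1) D by blast
  moreover have "large (\<Union>k. F k)" using large_UN F(2-4) .
  ultimately obtain z where z: "z \<in> \<Y>" "splits z (\<Union>k. F k)"
    using hs unfolding hereditarily_split_def by blast
  have "F k \<subseteq> z" for k
  proof (rule ccontr)
    assume "\<not> F k \<subseteq> z"
    then have "\<not> splits z (D (Suc k))" using Q[of k] z(1) unfolding Q_def by blast
    \<comment> \<open>Only finitely many points of the union lie outside \<open>D (Suc k)\<close>,
      so splitting the union would split \<open>D (Suc k)\<close>.\<close>
    have "F j \<subseteq> (\<Union>i\<le>k. F i) \<union> D (Suc k)" for j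
      using F(1)[of j] antimonoD[OF anti, of "Suc k" j] by (cases "j \<le> k") auto
    then have sub: "(\<Union>k. F k) \<subseteq> (\<Union>i\<le>k. F i) \<union> D (Suc k)" by blast
    have fin: "finite (\<Union>i\<le>k. F i)" using F(3) by blast
    have "large ((\<Union>k. F k) \<inter> z)" "large ((\<Union>k. F k) - z)"
      using z(2) by (simp_all add: splits_def)
    from this[THEN large_almost_subset[OF _ fin, where D = "D (Suc k)"]]
    have "large ((\<Union>k. F k) \<inter> z \<inter> D (Suc k))" "large (((\<Union>k. F k) - z) \<inter> D (Suc k))"
      using sub by (simp_all add: le_infI1 subset_trans[OF Diff_subset])
    then have "large (D (Suc k) \<inter> z)" "large (D (Suc k) - z)"
      by (elim large_mono, blast)+
    then have "splits z (D (Suc k))" by (simp add: splits_def)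
    then show False using \<open>\<not> splits z (D (Suc k))\<close> by blast
  qed
  then have "(\<Union>k. F k) - z = {}" by blast
  then show False
    using z(2) finite_not_large[of "(\<Union>k. F k) - z"] unfolding splits_def by (metis finite.emptyI)
qed

text \<open>The step is iterated on pairs of a family and a reservoir. Later members come from a
  family avoiding \<open>p j\<close>, and later points from a reservoir disjoint from
  \<open>y j\<close>; these are the two halves of orthogonality.\<close>

lemma hereditarily_split_imp_orthogonal_sequence:
  assumes "hereditarily_split \<Y> A"
  obtains y p where "\<And>k :: nat. y k \<in> \<Y>" "\<And>j k. p j \<in> y k \<longleftrightarrow> j = k"
proof -
  define Q where "Q s y p t \<longleftrightarrow> y \<in> fst s \<and> p \<in> snd s \<inter> y \<and> snd t \<subseteq> snd s - y \<and>
    fst t = {z \<in> fst s. p \<notin> z}" for s t :: "(nat \<times> 'a) set set \<times> (nat \<times> 'a) set" and y p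
  have "\<exists>s. \<forall>k. (hereditarily_split (fst (s k)) (snd (s k)) \<and> fst (s k) \<subseteq> \<Y>) \<and>
      (\<exists>y p. Q (s k) y p (s (Suc k)))"
  proof (rule dependent_nat_choice)
    show "\<exists>s. hereditarily_split (fst s) (snd s) \<and> fst s \<subseteq> \<Y>"
      using assms by (intro exI[of _ "(\<Y>, A)"]) auto
  next
    fix s :: "(nat \<times> 'a) set set \<times> (nat \<times> 'a) set" and k :: nat
    assume s: "hereditarily_split (fst s) (snd s) \<and> fst s \<subseteq> \<Y>"
    from hereditarily_split_step[OF conjunct1[OF s]]
    obtain y p D where "y \<in> fst s" "p \<in> snd s \<inter> y" "D \<subseteq> snd s - y"
      "hereditarily_split {z \<in> fst s. p \<notin> z} D"
      by (elim bexE exE conjE)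
    then show "\<exists>t. (hereditarily_split (fst t) (snd t) \<and> fst t \<subseteq> \<Y>) \<and> (\<exists>y p. Q s y p t)"
      using s by (intro exI[of _ "({z \<in> fst s. p \<notin> z}, D)"] exI[of _ y] exI[of _ p] conjI)
        (simp_all add: Q_def subset_iff)
  qed
  then obtain s where s: "\<forall>k. (hereditarily_split (fst (s k)) (snd (s k)) \<and> fst (s k) \<subseteq> \<Y>) \<and>
      (\<exists>y p. Q (s k) y p (s (Suc k)))" ..
  then obtain y p where Q: "\<And>k. Q (s k) (y k) (p k) (s (Suc k))"
    by metis
  have anti: "antimono (\<lambda>k. fst (s k))" "antimono (\<lambda>k. snd (s k))"
    using Q by (auto simp: Q_def decseq_Suc_iff)
  show thesis
  proof
    show "y k \<in> \<Y>" for k using Q[of k] s by (auto simp: Q_def)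
    show "p j \<in> y k \<longleftrightarrow> j = k" for j k
    proof (cases j k rule: linorder_cases)
      case less
      have "y k \<in> fst (s (Suc j))"
        using Q[of k] antimonoD[OF anti(1), of "Suc j" k] less by (auto simp: Q_def)
      then show ?thesis using Q[of j] less by (auto simp: Q_def)
    next
      case equal
      then show ?thesis using Q[of k] by (auto simp: Q_def)
    next
      case greater
      have "p j \<in> snd (s (Suc k))"
        using Q[of j] antimonoD[OF anti(2), of "Suc k" j] greater by (auto simp: Q_def)
      then show ?thesis using Q[of k] greater by (auto simp: Q_def)
    qed
  qed
qed

section \<open>Homogeneous sequences of blocks\<close>

lemma large_homogeneous_step:
  fixes tr :: "nat \<times> 'b \<Rightarrow> (nat \<times> 'b) set"
  assumes "large A"
  obtains E F n where "E \<subseteq> A" "large E" "F \<subseteq> A \<inter> fst -` {n}" "finite F" "k \<le> card F"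
    "\<And>i. i \<in> F \<Longrightarrow> E \<subseteq> tr i \<or> E \<inter> tr i = {}" "\<And>i. i \<in> E \<Longrightarrow> F \<subseteq> tr i \<or> F \<inter> tr i = {}"
proof -
  \<comment> \<open>Of \<open>2 * k\<close> points, at least \<open>k\<close> lie in
    \<open>T\<close> or at least \<open>k\<close> lie outside, for the \<open>T\<close> found
    below.\<close>
  obtain n G where G: "G \<subseteq> A" "G \<subseteq> fst -` {n}" "finite G" "2 * k \<le> card G"
    using assms by (rule largeE)
  \<comment> \<open>Each point \<open>q\<close> is coloured by the part of \<open>G\<close> in its
    own set \<open>tr q\<close> and by the members of \<open>G\<close> whose sets contain
    \<open>q\<close>. A large colour class is homogeneous in both directions.\<close>
  define f where "f q = (tr q \<inter> G, {i \<in> G. q \<in> tr i})" for q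
  have "finite (Pow G \<times> Pow G)" "f ` A \<subseteq> Pow G \<times> Pow G"
    using G(3) by (auto simp: f_def)
  then obtain c where large: "large {q \<in> A. f q = c}"
    using large_pigeonhole[OF _ assms] by blast
  obtain T U where "c = (T, U)" by fastforce
  define F where "F = (if k \<le> card (G \<inter> T) then G \<inter> T else G - T)"
  have "card G = card (G \<inter> T) + card (G - T)"
    using G(3) by (simp add: card_Int_Diff)
  then have "k \<le> card F" using G(4) by (auto simp: F_def)
  have "F \<subseteq> G" "F \<subseteq> T \<or> F \<inter> T = {}" by (auto simp: F_def)
  define E where "E = {q \<in> A. f q = c}"
  have E: "tr q \<inter> G = T" "\<And>i. i \<in> G \<Longrightarrow> q \<in> tr i \<longleftrightarrow> i \<in> U" if "q \<in> E" for q
    using that \<open>c = (T, U)\<close> by (auto simp: E_def f_def)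
  have "E \<subseteq> tr i \<or> E \<inter> tr i = {}" if "i \<in> F" for i
    using E(2)[of _ i] that \<open>F \<subseteq> G\<close> by (cases "i \<in> U") auto
  moreover have "F \<subseteq> tr q \<or> F \<inter> tr q = {}" if "q \<in> E" for q
    using E(1)[OF that] \<open>F \<subseteq> G\<close> \<open>F \<subseteq> T \<or> F \<inter> T = {}\<close> by blast
  moreover have "E \<subseteq> A" "large E" "F \<subseteq> A \<inter> fst -` {n}" "finite F"
    using large G(1-3) \<open>F \<subseteq> G\<close> finite_subset by (auto simp: E_def)
  ultimately show thesis
    using \<open>k \<le> card F\<close> by (intro that[of E F n])
qed

text \<open>The step controls the sets of the chosen points on the reservoir and those of reservoir
  points on the chosen set, which settles \<open>j > k\<close> and \<open>j < k\<close>
  respectively.\<close>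

lemma large_homogeneous_sequence:
  fixes tr :: "nat \<times> 'b \<Rightarrow> (nat \<times> 'b) set"
  assumes "large A"
  obtains F n where "\<And>k. F k \<subseteq> A \<inter> fst -` {n k}" "\<And>k. finite (F k)" "\<And>k. k \<le> card (F k)"
    "\<And>j k i. i \<in> F k \<Longrightarrow> j \<noteq> k \<Longrightarrow> F j \<subseteq> tr i \<or> F j \<inter> tr i = {}"
proof -
  define Q where "Q k D F n E \<longleftrightarrow> E \<subseteq> D \<and> F \<subseteq> D \<inter> fst -` {n} \<and> finite F \<and> k \<le> card F \<and>
      (\<forall>i\<in>F. E \<subseteq> tr i \<or> E \<inter> tr i = {}) \<and> (\<forall>i\<in>E. F \<subseteq> tr i \<or> F \<inter> tr i = {})"
    for k :: nat and D F n E
  have "\<exists>D. \<forall>k. (D k \<subseteq> A \<and> large (D k)) \<and> (\<exists>F n. Q k (D k) F n (D (Suc k)))"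
  proof (rule dependent_nat_choice)
    show "\<exists>D. D \<subseteq> A \<and> large D" using assms by blast
    show "\<exists>E. (E \<subseteq> A \<and> large E) \<and> (\<exists>F n. Q k D F n E)" if "D \<subseteq> A \<and> large D" for D k
    proof -
      obtain E F n where "E \<subseteq> D" "large E" "F \<subseteq> D \<inter> fst -` {n}" "finite F" "k \<le> card F"
        "\<And>i. i \<in> F \<Longrightarrow> E \<subseteq> tr i \<or> E \<inter> tr i = {}" "\<And>i. i \<in> E \<Longrightarrow> F \<subseteq> tr i \<or> F \<inter> tr i = {}"
        using conjunct2[OF \<open>D \<subseteq> A \<and> large D\<close>] by (rule large_homogeneous_step[where k = k and tr = tr]) blast
      then have "Q k D F n E" unfolding Q_def by blast
      then show ?thesis using that \<open>E \<subseteq> D\<close> \<open>large E\<close> by blast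
    qed
  qed
  then obtain D where D: "\<And>k. D k \<subseteq> A" and "\<And>k. \<exists>F n. Q k (D k) F n (D (Suc k))"
    by auto
  then obtain F n where Q: "\<And>k. Q k (D k) (F k) (n k) (D (Suc k))"
    by metis
  have anti: "antimono D"
    using Q by (auto simp: Q_def decseq_Suc_iff)
  have later: "F j \<subseteq> D (Suc k)" if "k < j" for j k
    using Q[of j] antimonoD[OF anti, of "Suc k" j] that by (auto simp: Q_def)
  show thesis
  proof
    show "F k \<subseteq> A \<inter> fst -` {n k}" "finite (F k)" "k \<le> card (F k)" for k
      using Q[of k] D[of k] by (auto simp: Q_def)
    show "F j \<subseteq> tr i \<or> F j \<inter> tr i = {}" if "i \<in> F k" "j \<noteq> k" for i j k
    proof (cases "j < k")
      case True
      then show ?thesis using later[of j k] Q[of j] that(1) unfolding Q_def by blast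
    next
      case False
      then have "k < j" using that(2) by simp
      then show ?thesis using later[of k j] Q[of k] that(1) unfolding Q_def by blast
    qed
  qed
qed

section \<open>Weights from traces\<close>

text \<open>The almost-filters are the sets \<open>X k\<close> below, witnessed by the generators
  \<open>g k i\<close> with \<open>i \<in> F k\<close>. The sets \<open>B k\<close> are those that
  members of \<open>X k\<close> must avoid.\<close>

lemma non_AMNM_weight_of_traces:
  fixes mul :: "'a \<Rightarrow> 'a \<Rightarrow> 'a" and tr :: "'a \<Rightarrow> 'p set" and F B :: "nat \<Rightarrow> 'p set"
  assumes "semilattice mul" and tr_mul: "\<And>x y. tr (mul x y) = tr x \<union> tr y"
    and finF: "\<And>k. finite (F k)" and cardF: "\<And>k. k + 2 \<le> card (F k)"
    and g_F: "\<And>k i. i \<in> F k \<Longrightarrow> tr (g k i) \<inter> F k = {i}"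
    and g_B: "\<And>k i. i \<in> F k \<Longrightarrow> tr (g k i) \<inter> B k = {}"
    and g_other: "\<And>j k i. i \<in> F k \<Longrightarrow> j \<noteq> k \<Longrightarrow> F j \<subseteq> tr (g k i) \<or> F j \<inter> tr (g k i) = {}"
    and bounded: "\<And>x. \<exists>M. \<forall>k. tr x \<inter> B k = {} \<longrightarrow> 2 * card (tr x \<inter> F k) \<le> card (F k) \<longrightarrow>
      card (tr x \<inter> F k) \<le> M"
  shows "\<exists>\<omega> :: 'a \<Rightarrow> real. submultiplicative_weight mul \<omega> \<and> \<not> AMNM (weighted_l1 mul \<omega>)"
proof -
  interpret semilattice mul by fact
  interpret prod: semilattice_set mul ..
  define X where "X k = {x. tr x \<inter> B k = {} \<and> 2 * card (tr x \<inter> F k) \<le> card (F k)}" for k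
  \<comment> \<open>The default 0 outside \<open>X k\<close> keeps \<open>c k\<close> subadditive,
    since both factors of a product in \<open>X k\<close> lie in \<open>X k\<close>.\<close>
  define c where "c k x = (if x \<in> X k then card (tr x \<inter> F k) else 0)" for k x
  define l where "l x = (SUP k. c k x)" for x
  define \<omega> :: "'a \<Rightarrow> real" where "\<omega> x = 2 ^ l x" for x
  have card_mul: "card (tr x \<inter> F k) \<le> card (tr (mul x y) \<inter> F k)"
    "card (tr (mul x y) \<inter> F k) \<le> card (tr x \<inter> F k) + card (tr y \<inter> F k)" for k x y
    using finF by (auto simp: tr_mul Int_Un_distrib2 card_Un_le intro!: card_mono)
  have X_mul: "x \<in> X k" if "mul x y \<in> X k" for k x y
    using that card_mul(1)[of x k y] by (auto simp: X_def tr_mul)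
  have c_mul: "c k (mul x y) \<le> c k x + c k y" for k x y
    using X_mul[of x y k] X_mul[of y x k] card_mul(2)[of x y k] by (auto simp: c_def commute)
  \<comment> \<open>This is the purpose of \<open>bounded\<close>: the supremum \<open>l x\<close>
    is meaningful only for a bounded family.\<close>
  have c_le_l: "c k x \<le> l x" for k x
  proof -
    obtain M where "\<forall>k. tr x \<inter> B k = {} \<longrightarrow> 2 * card (tr x \<inter> F k) \<le> card (F k) \<longrightarrow>
        card (tr x \<inter> F k) \<le> M"
      using bounded by blast
    then have "bdd_above (range (\<lambda>k. c k x))"
      by (intro bdd_aboveI2[of _ _ M]) (auto simp: c_def X_def)
    then show ?thesis unfolding l_def by (intro cSUP_upper) auto
  qed
  have l_le: "l x \<le> m" if "\<And>k. c k x \<le> m" for x m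
    unfolding l_def by (rule cSUP_least) (use that in auto)
  have "l (mul x y) \<le> l x + l y" for x y
    by (rule l_le) (meson add_mono c_le_l c_mul order_trans)
  then have \<omega>: "submultiplicative_weight mul \<omega>"
    unfolding submultiplicative_weight_def \<omega>_def
    by (auto simp flip: power_add intro!: power_increasing)
  \<comment> \<open>A trace containing all of \<open>F j\<close> exceeds half of it, so the default
    value applies.\<close>
  have full_or_disjoint: "c j x = 0" if "F j \<subseteq> tr x \<or> F j \<inter> tr x = {}" for j x
  proof (cases "F j \<subseteq> tr x")
    case True
    then show ?thesis using cardF[of j] by (simp add: c_def X_def Int_absorb1)
  next
    case False
    then show ?thesis using that by (simp add: c_def Int_commute)
  qed
  have "l (g k i) \<le> 1" if "i \<in> F k" for k i
  proof (rule l_le)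
    fix j
    show "c j (g k i) \<le> 1"
      using g_F[OF that] full_or_disjoint[OF g_other[OF that]]
      by (cases "j = k") (auto simp: c_def)
  qed
  then have \<omega>_g: "\<omega> (g k i) \<le> 2" if "i \<in> F k" for k i
    using that power_increasing[of "l (g k i)" 1 "2::real"] by (simp add: \<omega>_def)
  have tr_prod: "tr (prod.F G) = (\<Union>x\<in>G. tr x)" if "finite G" "G \<noteq> {}" for G
    using that by (induction G rule: finite_ne_induct) (auto simp: tr_mul)
  \<comment> \<open>The trace of \<open>z k\<close> contains or misses each \<open>F j\<close>
    entirely, so \<open>z k\<close> has weight 1 although it lies outside
    \<open>X k\<close>.\<close>
  define z where "z k = prod.F (g k ` F k)" for k
  have nonempty: "F k \<noteq> {}" for k using cardF[of k] by auto
  have tr_z: "tr (z k) = (\<Union>i\<in>F k. tr (g k i))" for k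
    unfolding z_def by (subst tr_prod) (use finF nonempty in auto)
  have F_z: "F k \<subseteq> tr (z k)" for k
    using g_F tr_z by fastforce
  have "F j \<subseteq> tr (z k) \<or> F j \<inter> tr (z k) = {}" for j k
  proof (cases "j = k")
    case False
    then show ?thesis using g_other[OF _ False] unfolding tr_z by blast
  qed (use F_z in auto)
  then have "l (z k) = 0" for k
    using l_le[of "z k" 0] full_or_disjoint by simp
  then have \<omega>_z: "\<omega> (z k) \<le> 2" for k
    by (simp add: \<omega>_def)
  have "\<not> AMNM (weighted_l1 mul \<omega>)"
  proof (rule not_AMNM_if_almost_filters[OF assms(1) \<omega>, of 2])
    fix \<delta> :: real
    assume "\<delta> > 0"
    obtain n where n: "1 / \<delta> < 2 ^ n"
      using real_arch_pow[of 2 "1 / \<delta>"] by auto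
    \<comment> \<open>Then any set of fewer than \<open>n\<close> points is at most half of
      \<open>F k\<close>.\<close>
    define k where "k = 2 * n"
    have "mul x y \<in> X k" if "\<omega> x * \<omega> y \<le> 1 / \<delta>" "x \<in> X k" "y \<in> X k" for x y
    proof -
      have "(2::real) ^ (l x + l y) < 2 ^ n"
        using that(1) n by (simp add: \<omega>_def power_add)
      then have "l x + l y < n" by simp
      moreover have "card (tr x \<inter> F k) \<le> l x" "card (tr y \<inter> F k) \<le> l y"
        using c_le_l[of k x] c_le_l[of k y] that(2,3) by (auto simp: c_def)
      ultimately have "card (tr (mul x y) \<inter> F k) < n"
        using card_mul(2)[of x y k] by linarith
      then show ?thesis
        using that(2,3) cardF[of k] by (auto simp: X_def k_def tr_mul)
    qed
    then have "\<omega> x * \<omega> y \<le> 1 / \<delta> \<Longrightarrow> mul x y \<in> X k \<longleftrightarrow> x \<in> X k \<and> y \<in> X k" for x y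
      using X_mul[of x y k] X_mul[of y x k] by (auto simp: commute)
    moreover have "g k ` F k \<subseteq> X k"
    proof -
      \<comment> \<open>A single point is at most half of \<open>F k\<close> because
        \<open>F k\<close> has at least two points, even for \<open>k = 0\<close>.\<close>
      have "g k i \<in> X k" if "i \<in> F k" for i
        using g_F[OF that] g_B[OF that] cardF[of k] by (simp add: X_def)
      then show ?thesis by blast
    qed
    moreover have "z k \<notin> X k"
      using F_z[of k] cardF[of k] by (simp add: X_def Int_absorb1)
    ultimately show "\<exists>X G. (\<forall>x y. \<omega> x * \<omega> y \<le> 1 / \<delta> \<longrightarrow> (mul x y \<in> X \<longleftrightarrow> x \<in> X \<and> y \<in> X)) \<and>
        finite G \<and> G \<noteq> {} \<and> G \<subseteq> X \<and> (\<forall>g\<in>G. \<omega> g \<le> 2) \<and>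
        prod.F G \<notin> X \<and> \<omega> (prod.F G) \<le> 2"
      using finF nonempty \<omega>_g \<omega>_z[of k] unfolding z_def
      by (intro exI[of _ "X k"] exI[of _ "g k ` F k"]) auto
  qed simp
  then show ?thesis using \<omega> by blast
qed

section \<open>The two cases: orthogonal traces and unsplit large sets\<close>

lemma non_AMNM_weight_of_orthogonal_traces:
  fixes mul :: "'a \<Rightarrow> 'a \<Rightarrow> 'a" and tr :: "'a \<Rightarrow> 'p set" and h :: "nat \<Rightarrow> 'a"
  assumes "semilattice mul" and tr_mul: "\<And>x y. tr (mul x y) = tr x \<union> tr y"
    and p: "\<And>j k. p j \<in> tr (h k) \<longleftrightarrow> j = k"
  shows "\<exists>\<omega> :: 'a \<Rightarrow> real. submultiplicative_weight mul \<omega> \<and> \<not> AMNM (weighted_l1 mul \<omega>)"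
proof -
  \<comment> \<open>Indexing the points by pairs arranges them in infinitely many rows;
    \<open>F k\<close> consists of the first \<open>k + 2\<close> points of row
    \<open>k\<close>.\<close>
  define q where "q a = p (prod_encode a)" for a
  define u where "u x = h (prod_encode (inv q x))" for x
  have "inj q"
    unfolding q_def inj_def using p prod_encode_eq by metis
  then have qu: "q a \<in> tr (u (q b)) \<longleftrightarrow> a = b" for a b
    by (simp add: u_def) (simp add: q_def p)
  define F where "F k = q ` ({k} \<times> {..<k + 2})" for k
  define B where "B k = (\<Union>j\<in>-{k}. F j)" for k
  show ?thesis
  proof (rule non_AMNM_weight_of_traces[OF assms(1) tr_mul, of F "\<lambda>_. u" B])
    fix k
    show "finite (F k)" by (simp add: F_def)
    show "k + 2 \<le> card (F k)"
      unfolding F_def using \<open>inj q\<close> by (subst card_image) (auto intro: inj_on_subset)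
    fix i
    assume "i \<in> F k"
    then obtain b where b: "i = q (k, b)" "b < k + 2" by (auto simp: F_def)
    show "tr (u i) \<inter> F k = {i}" using b qu by (auto simp: F_def)
    show "tr (u i) \<inter> B k = {}" using b qu by (auto simp: B_def F_def)
    show "F j \<subseteq> tr (u i) \<or> F j \<inter> tr (u i) = {}" if "j \<noteq> k" for j
      using that b qu by (auto simp: F_def)
  next
    fix x
    show "\<exists>M. \<forall>k. tr x \<inter> B k = {} \<longrightarrow> 2 * card (tr x \<inter> F k) \<le> card (F k) \<longrightarrow>
        card (tr x \<inter> F k) \<le> M"
    \<comment> \<open>A trace meeting \<open>F k0\<close> meets \<open>B k\<close> for every
      \<open>k \<noteq> k0\<close>, so at most one block matters.\<close>
    proof (cases "\<exists>k. tr x \<inter> F k \<noteq> {}")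
      case True
      then obtain k0 where "tr x \<inter> F k0 \<noteq> {}" ..
      then have "k = k0" if "tr x \<inter> B k = {}" for k
        using that by (auto simp: B_def)
      then show ?thesis by (intro exI[of _ "card (tr x \<inter> F k0)"]) auto
    qed auto
  qed
qed

lemma non_AMNM_weight_of_unsplit_traces:
  fixes mul :: "'a \<Rightarrow> 'a \<Rightarrow> 'a" and tr :: "'a \<Rightarrow> (nat \<times> 'b) set" and g :: "nat \<times> 'b \<Rightarrow> 'a"
  assumes "semilattice mul" and tr_mul: "\<And>x y. tr (mul x y) = tr x \<union> tr y"
    and gen: "\<And>i. i \<in> A \<Longrightarrow> tr (g i) \<inter> fst -` {fst i} = {i}"
    and "large A" and unsplit: "\<And>x. \<not> splits (tr x) A"
  shows "\<exists>\<omega> :: 'a \<Rightarrow> real. submultiplicative_weight mul \<omega> \<and> \<not> AMNM (weighted_l1 mul \<omega>)"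
proof -
  obtain F n where F: "\<And>k. F k \<subseteq> A \<inter> fst -` {n k}" "\<And>k. finite (F k)" "\<And>k. k \<le> card (F k)"
    "\<And>j k i. i \<in> F k \<Longrightarrow> j \<noteq> k \<Longrightarrow> F j \<subseteq> tr (g i) \<or> F j \<inter> tr (g i) = {}"
    by (rule large_homogeneous_sequence[OF \<open>large A\<close>, of "\<lambda>i. tr (g i)"]) blast
  show ?thesis
  \<comment> \<open>The shift by 2 supplies the required cardinality bound.\<close>
  proof (rule non_AMNM_weight_of_traces[OF assms(1) tr_mul,
        of "\<lambda>k. F (k + 2)" "\<lambda>_. g" "\<lambda>_. {}"])
    fix k i
    assume i: "i \<in> F (k + 2)"
    then have "i \<in> A" "fst i = n (k + 2)" using F(1)[of "k + 2"] by auto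
    then have "tr (g i) \<inter> fst -` {n (k + 2)} = {i}" using gen[of i] by simp
    then show "tr (g i) \<inter> F (k + 2) = {i}"
      using i F(1)[of "k + 2"] by blast
  next
    fix x
    consider "\<not> large (A \<inter> tr x)" | "\<not> large (A - tr x)"
      using unsplit[of x] unfolding splits_def by blast
    then show "\<exists>M. \<forall>k. tr x \<inter> {} = {} \<longrightarrow> 2 * card (tr x \<inter> F (k + 2)) \<le> card (F (k + 2)) \<longrightarrow>
        card (tr x \<inter> F (k + 2)) \<le> M"
    proof cases
      case 1
      then obtain K where K: "\<And>n G. G \<subseteq> A \<inter> tr x \<Longrightarrow> G \<subseteq> fst -` {n} \<Longrightarrow> finite G \<Longrightarrow> card G < K"
        by (rule not_largeE) blast
      have "card (tr x \<inter> F k) < K" for k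
        by (rule K[of _ "n k"]) (use F(1,2)[of k] in auto)
      then show ?thesis by (auto intro: less_imp_le)
    next
      \<comment> \<open>If at most half of \<open>F k\<close> lies in the trace, this part is no
        larger than the rest of \<open>F k\<close>, which is bounded.\<close>
      case 2
      then obtain K where K: "\<And>n G. G \<subseteq> A - tr x \<Longrightarrow> G \<subseteq> fst -` {n} \<Longrightarrow> finite G \<Longrightarrow> card G < K"
        by (rule not_largeE) blast
      have "card (F k - tr x) < K" for k
        by (rule K[of _ "n k"]) (use F(1,2)[of k] in auto)
      moreover have "card (F k) = card (tr x \<inter> F k) + card (F k - tr x)" for k
        using card_Int_Diff[of "F k" "tr x"] F(2) by (simp add: Int_commute)
      ultimately have "2 * card (tr x \<inter> F k) \<le> card (F k) \<longrightarrow> card (tr x \<inter> F k) \<le> K" for k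
        using less_imp_le[of "card (F k - tr x)" K] by simp
      then show ?thesis by blast
    qed
  qed (use F(2-4) in auto)
qed

section \<open>Traces from incompressible sets and the dichotomy\<close>

lemma incompressible_sets_if_infinite_breadth:
  assumes "breadth mul = \<infinity>"
  obtains E where "\<And>n :: nat. incompressible mul (E n)" "\<And>n. n \<le> card (E n)"
proof -
  have "\<exists>E. incompressible mul E \<and> n \<le> card E" for n
  proof (rule ccontr)
    assume "\<not> ?thesis"
    then have "\<And>E. incompressible mul E \<Longrightarrow> card E \<le> n"
      by (meson nat_le_linear)
    then have "breadth mul \<le> enat n"
      unfolding breadth_def by (auto intro!: Sup_least)
    then show False using assms by simp
  qed
  then obtain E where "\<And>n. incompressible mul (E n) \<and> n \<le> card (E n)"
    by metis
  then show thesis using that[of E] by blast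
qed

theorem theoremB:
  fixes mul :: "'a \<Rightarrow> 'a \<Rightarrow> 'a"
  assumes "semilattice mul"
    and "breadth mul = \<infinity>"
  shows "\<exists>\<omega> :: 'a \<Rightarrow> real. submultiplicative_weight mul \<omega> \<and> \<not> AMNM (weighted_l1 mul \<omega>)"
proof -
  interpret semilattice mul by fact
  interpret prod: semilattice_set mul ..
  obtain E' where E': "\<And>n :: nat. incompressible mul (E' n)" "\<And>n. n \<le> card (E' n)"
    using incompressible_sets_if_infinite_breadth[OF assms(2)] by blast
  \<comment> \<open>The shift ensures two elements in each set, so that no product
    \<open>P n e\<close> is empty.\<close>
  define E where "E n = E' (n + 2)" for n
  have E: "incompressible mul (E n)" "n + 2 \<le> card (E n)" for n
    using E' by (auto simp: E_def)
  have finE: "finite (E n)" for n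
    using E(1)[of n] by (simp add: incompressible_def)
  define P where "P n e = prod.F (E n - {e})" for n e
  define tr where "tr y = {(n, e). e \<in> E n \<and> mul y (P n e) \<noteq> P n e}" for y
  \<comment> \<open>In the order with \<open>mul\<close> as meet, a product lies above
    \<open>p\<close> iff both factors do.\<close>
  have "mul (mul x y) p = p \<longleftrightarrow> mul x p = p \<and> mul y p = p" for x y p
    by (metis assoc commute left_idem)
  then have tr_mul: "tr (mul x y) = tr x \<union> tr y" for x y
    by (auto simp: tr_def)
  have tr_gen: "tr e \<inter> fst -` {n} = {(n, e)}" if "e \<in> E n" for n e
  proof -
    have "E n - {e} \<noteq> {}"
    proof
      assume "E n - {e} = {}"
      then have "card (E n) \<le> card {e}" by (intro card_mono) auto
      then show False using E(2)[of n] by simp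
    qed
    moreover have "insert e (E n - {e}) = E n" using that by blast
    ultimately have "mul e (P n e) = prod.F (E n)"
      using prod.insert_not_elem[of "E n - {e}" e] finE[of n] by (simp add: P_def)
    \<comment> \<open>Incompressibility puts \<open>(n, e)\<close> into the trace of
      \<open>e\<close>; other points of the block are absent because \<open>e\<close> is a factor of
      \<open>P n e'\<close> for \<open>e' \<noteq> e\<close>.\<close>
    moreover have "P n e \<noteq> prod.F (E n)"
    proof
      assume "P n e = prod.F (E n)"
      then have "compressible mul (E n)"
        unfolding compressible_def P_def using that finE \<open>E n - {e} \<noteq> {}\<close>
        by (intro conjI exI[of _ "E n - {e}"]) auto
      then show False using E(1)[of n] by (simp add: incompressible_def)
    qed
    ultimately have "mul e (P n e) \<noteq> P n e" by simp
    moreover have "e' = e" if "mul e (P n e') \<noteq> P n e'" for e'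
      using that prod.in_idem[of "E n - {e'}" e] finE \<open>e \<in> E n\<close> by (auto simp: P_def)
    ultimately show ?thesis using that by (auto simp: tr_def)
  qed
  define \<Omega> where "\<Omega> = Sigma UNIV E"
  have "large (\<Union>n. {n} \<times> E n)"
    by (rule large_UN[of _ "\<lambda>n. n"]) (use finE add_leD1[OF E(2)] in \<open>auto simp: card_cartesian_product\<close>)
  then have "large \<Omega>" by (rule large_mono) (auto simp: \<Omega>_def)
  show ?thesis
  proof (cases "hereditarily_split (range tr) \<Omega>")
    case True
    obtain y p where y: "\<And>k :: nat. y k \<in> range tr" and p: "\<And>j k. p j \<in> y k \<longleftrightarrow> j = k"
      using hereditarily_split_imp_orthogonal_sequence[OF True] by metis
    have "p j \<in> tr (inv tr (y k)) \<longleftrightarrow> j = k" for j k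
      using p by (simp add: f_inv_into_f[OF y])
    then show ?thesis
      by (rule non_AMNM_weight_of_orthogonal_traces[OF assms(1) tr_mul])
  next
    case False
    \<comment> \<open>Since \<open>\<Omega>\<close> itself is large, hereditary splitting can fail
      only through a large subset that no trace splits.\<close>
    then obtain A where A: "A \<subseteq> \<Omega>" "large A" "\<And>x. \<not> splits (tr x) A"
      using \<open>large \<Omega>\<close> by (auto simp: hereditarily_split_def)
    have "tr (snd i) \<inter> fst -` {fst i} = {i}" if "i \<in> A" for i
    proof -
      have "snd i \<in> E (fst i)" using that A(1) by (auto simp: \<Omega>_def)
      from tr_gen[OF this] show ?thesis by simp
    qed
    then show ?thesis
      by (rule non_AMNM_weight_of_unsplit_traces[OF assms(1) tr_mul _ A(2,3)])
  qed
qed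

end
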